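(* Let $C, K$ be real $n\times n$ matrices, let $D, B$ be real diagonal $n\times n$ matrices, and let $T_1,T_2,T_3,T_4$ be real $n\times n$ matrices such that the linear map $$f:\mathbb{R}^{2n}\to\mathbb{R}^{2n},\qquad f(\mathbf{p},\dot{\mathbf{p}}) = (T_1\mathbf{p}+T_2\dot{\mathbf{p}},\; T_3\mathbf{p}+T_4\dot{\mathbf{p}})$$ is invertible. Let $\Gamma_C$ be the vector field on $\mathbb{R}^{2n}$ (coordinates $(\mathbf{q},\dot{\mathbf{q}})$) associated with the second-order system $\ddot{\mathbf{q}}+C\dot{\mathbf{q}}+K\mathbf{q}=0$, and let $\Gamma_D$ be the vector field on $\mathbb{R}^{2n}$ (coordinates $(\mathbf{p},\dot{\mathbf{p}})$) associated with the decoupled second-order system $\ddot{\mathbf{p}}+D\dot{\mathbf{p}}+B\mathbf{p}=0$. Then $\Gamma_D$ and $\Gamma_C$ are $f$-related, i.e. $Tf\circ\Gamma_D=\Gamma_C\circ f$, if and only if the following four matrix relations hold: $$T_3=-T_2B,\qquad T_1=T_4+T_2D,\qquad T_4D=T_3+CT_4+KT_2,\qquad T_4B=CT_3+KT_1.$$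
   Context: A second-order system $\ddot{\mathbf{x}}=g(\mathbf{x},\dot{\mathbf{x}})$ on $\mathbb{R}^n$ is identified with the vector field $\sum_i \dot{x}^i\,\partial/\partial x^i+\sum_i g^i(\mathbf{x},\dot{\mathbf{x}})\,\partial/\partial\dot{x}^i$ on $T\mathbb{R}^n\cong\mathbb{R}^{2n}$, where $\mathbf{x}$ and $\dot{\mathbf{x}}$ denote independent coordinates. Thus $$\Gamma_C=\sum_i\dot{q}^i\frac{\partial}{\partial q^i}-\sum_{i,j}(C^i_j\dot{q}^j+K^i_jq^j)\frac{\partial}{\partial\dot{q}^i},\qquad \Gamma_D=\sum_i\dot{p}^i\frac{\partial}{\partial p^i}-\sum_{i,j}(D^i_j\dot{p}^j+B^i_jp^j)\frac{\partial}{\partial\dot{p}^i}.$$ $Tf$ denotes the tangent map of $f$. Equivalently, $f$-relatedness means that $\Gamma_C(h)\circ f=\Gamma_D(h\circ f)$ for every smooth function $h(\mathbf{q},\dot{\mathbf{q}})$ on $\mathbb{R}^{2n}$. No symmetry assumption is made on $C$ or $K$. *)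

theory Defs
  imports "HOL-Analysis.Analysis"
begin

text \<open>
  The tangent bundle of a normed space \<open>'a\<close> is \<open>'a \<times> 'a\<close>, a pair consisting of a base point
  and a tangent vector at it. A vector field \<open>X :: 'a \<Rightarrow> 'a \<times> 'a\<close> is a section of it, so
  \<open>fst (X z) = z\<close>.
\<close>

text \<open>Only meaningful for differentiable maps, as \<open>frechet_derivative\<close> is unspecified otherwise.\<close>

definition tangent_map ::
    "('a::real_normed_vector \<Rightarrow> 'b::real_normed_vector) \<Rightarrow> 'a \<times> 'a \<Rightarrow> 'b \<times> 'b" where
  "tangent_map f = (\<lambda>(z, w). (f z, frechet_derivative f (at z) w))"

definition related_vector_fields ::
    "('a::real_normed_vector \<Rightarrow> 'b::real_normed_vector) \<Rightarrow>
      ('a \<Rightarrow> 'a \<times> 'a) \<Rightarrow> ('b \<Rightarrow> 'b \<times> 'b) \<Rightarrow> bool" where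
  "related_vector_fields f X Y \<longleftrightarrow> tangent_map f \<circ> X = Y \<circ> f"

text \<open>
  The vector field of \<open>x'' = g x x'\<close>. The state space is \<open>real^'n \<times> real^'n\<close>; in
  \<open>((x, v), (v, g x v))\<close> the second pair holds the coefficients of the coordinate fields of
  \<open>x\<close> and of \<open>v\<close>, respectively.
\<close>

definition second_order_field ::
    "(real^'n \<Rightarrow> real^'n \<Rightarrow> real^'n) \<Rightarrow>
      (real^'n) \<times> (real^'n) \<Rightarrow> ((real^'n) \<times> (real^'n)) \<times> ((real^'n) \<times> (real^'n))" where
  "second_order_field g = (\<lambda>(x, v). ((x, v), (v, g x v)))"

text \<open>The vector field of \<open>x'' + C x' + K x = 0\<close>.\<close>

definition linear_second_order_field ::
    "real^'n^'n \<Rightarrow> real^'n^'n \<Rightarrow>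
      (real^'n) \<times> (real^'n) \<Rightarrow> ((real^'n) \<times> (real^'n)) \<times> ((real^'n) \<times> (real^'n))" where
  "linear_second_order_field C K = second_order_field (\<lambda>x v. - (C *v v + K *v x))"

definition block_map ::
    "real^'n^'n \<Rightarrow> real^'n^'n \<Rightarrow> real^'n^'n \<Rightarrow> real^'n^'n \<Rightarrow>
      (real^'n) \<times> (real^'n) \<Rightarrow> (real^'n) \<times> (real^'n)" where
  "block_map T1 T2 T3 T4 = (\<lambda>(p, v). (T1 *v p + T2 *v v, T3 *v p + T4 *v v))"

definition diagonal_matrix :: "real^'n^'n \<Rightarrow> bool" where
  "diagonal_matrix A \<longleftrightarrow> (\<forall>i j. i \<noteq> j \<longrightarrow> A $ i $ j = 0)"

end

(* Both fields have the form z \<mapsto> (z, A z) with A a block map, and the linear map f is its own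
   derivative, so f-relatedness means f A_D = A_C f; compare the four blocks. *)
theory Submission
  imports Defs
begin

text \<open>Each field attaches to a state its image under a companion matrix, and \<open>f\<close>
  is its own derivative at every point (\<open>tangent_map_linear\<close>). Base points agree
  automatically, so relatedness is an intertwining identity between the two companion matrices.
  Multiplying out 2-by-2 blocks (\<open>block_map_compose\<close>) and comparing entries
  (\<open>block_map_eq_iff\<close>) gives one relation per block.\<close>

lemma linear_block_map: "linear (block_map T1 T2 T3 T4)"
  by (rule linearI)
    (auto simp: block_map_def matrix_vector_right_distrib matrix_vector_mult_scaleR algebra_simps)

text \<open>In finite dimension a linear map is bounded, hence differentiable with itself as
  derivative.\<close>

lemma tangent_map_linear:
  fixes f :: "'a::euclidean_space \<Rightarrow> 'b::real_normed_vector"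
  assumes "linear f"
  shows "tangent_map f (z, w) = (f z, f w)"
  using frechet_derivative_at[OF linear_imp_has_derivative[OF assms], of z]
  by (simp add: tangent_map_def)

text \<open>States with zero velocity isolate the first block column, states with zero position the
  second.\<close>

lemma block_map_eq_iff:
  "block_map S1 S2 S3 S4 = block_map T1 T2 T3 T4 \<longleftrightarrow> S1 = T1 \<and> S2 = T2 \<and> S3 = T3 \<and> S4 = T4"
proof
  assume eq: "block_map S1 S2 S3 S4 = block_map T1 T2 T3 T4"
  have "S1 *v x = T1 *v x" "S3 *v x = T3 *v x" for x
    using fun_cong[OF eq, of "(x, 0)"] by (simp_all add: block_map_def)
  moreover have "S2 *v x = T2 *v x" "S4 *v x = T4 *v x" for x
    using fun_cong[OF eq, of "(0, x)"] by (simp_all add: block_map_def)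
  ultimately show "S1 = T1 \<and> S2 = T2 \<and> S3 = T3 \<and> S4 = T4"
    by (simp add: matrix_eq)
qed simp

lemma block_map_compose:
  "block_map S1 S2 S3 S4 (block_map T1 T2 T3 T4 z) =
     block_map (S1 ** T1 + S2 ** T3) (S1 ** T2 + S2 ** T4)
       (S3 ** T1 + S4 ** T3) (S3 ** T2 + S4 ** T4) z"
  by (cases z) (simp add: block_map_def matrix_vector_right_distrib
      matrix_vector_mult_add_rdistrib matrix_vector_mul_assoc algebra_simps)

lemma matrix_vector_mult_uminus_left: "(- A) *v x = - (A *v x)" for A :: "real^'n^'m"
  using matrix_vector_mult_diff_rdistrib[of 0 A x] by simp

text \<open>The companion matrix of x' = v, v' = - K x - C v. Position comes first, so
  \<open>K\<close> stands before \<open>C\<close> in the lower row.\<close>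

lemma linear_second_order_field_eq:
  "linear_second_order_field C K z = (z, block_map 0 (mat 1) (- K) (- C) z)"
  by (cases z) (simp add: linear_second_order_field_def second_order_field_def block_map_def
      matrix_vector_mult_uminus_left)

lemma matrix_mult_uminus_right: "A ** (- B) = - (A ** B)"
  for A :: "'a::ring_1^'n^'m" and B :: "'a^'k^'n"
  by (simp add: matrix_matrix_mult_def vec_eq_iff sum_negf)

lemma matrix_mult_uminus_left: "(- A) ** B = - (A ** B)"
  for A :: "'a::ring_1^'n^'m" and B :: "'a^'k^'n"
  by (simp add: matrix_matrix_mult_def vec_eq_iff sum_negf)

theorem mainTheorem1:
  fixes C K D B T1 T2 T3 T4 :: "real^'n^'n"
  assumes "diagonal_matrix D" and "diagonal_matrix B"
    and "bij (block_map T1 T2 T3 T4)"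
  shows "related_vector_fields (block_map T1 T2 T3 T4)
           (linear_second_order_field D B) (linear_second_order_field C K) \<longleftrightarrow>
         T3 = - (T2 ** B) \<and>
         T1 = T4 + T2 ** D \<and>
         T4 ** D = T3 + C ** T4 + K ** T2 \<and>
         T4 ** B = C ** T3 + K ** T1"
proof -
  \<comment> \<open>The left block map is \<open>f\<close> after the companion matrix of
    \<open>D\<close> and \<open>B\<close>; the right one is the companion matrix of \<open>C\<close>
    and \<open>K\<close> after \<open>f\<close>.\<close>
  have "related_vector_fields (block_map T1 T2 T3 T4)
          (linear_second_order_field D B) (linear_second_order_field C K) \<longleftrightarrow>
        block_map (- (T2 ** B)) (T1 - T2 ** D) (- (T4 ** B)) (T3 - T4 ** D) =
        block_map T3 T4 (- (K ** T1) - C ** T3) (- (K ** T2) - C ** T4)"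
    by (simp add: related_vector_fields_def fun_eq_iff linear_second_order_field_eq
        tangent_map_linear[OF linear_block_map] block_map_compose
        matrix_mult_uminus_left matrix_mult_uminus_right del: split_paired_All)
  also have "\<dots> \<longleftrightarrow> T3 = - (T2 ** B) \<and> T1 - T2 ** D = T4 \<and>
      - (T4 ** B) = - (K ** T1) - C ** T3 \<and> T3 - T4 ** D = - (K ** T2) - C ** T4"
    by (auto simp: block_map_eq_iff)
  also have "\<dots> \<longleftrightarrow> T3 = - (T2 ** B) \<and> T1 = T4 + T2 ** D \<and>
      T4 ** D = T3 + C ** T4 + K ** T2 \<and> T4 ** B = C ** T3 + K ** T1"
  proof -
    have neg: "- X = - Y - Z \<longleftrightarrow> X = Y + Z" for X Y Z :: "real^'n^'n"
      using neg_equal_iff_equal[of X "Y + Z"] by simp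
    \<comment> \<open>The lower right block needs the same sign change, with \<open>T3 - X\<close>
      read as the negative of \<open>X - T3\<close>.\<close>
    have "T3 - X = - Y - Z \<longleftrightarrow> X = Y + Z + T3" for X Y Z :: "real^'n^'n"
      using neg[of "X - T3" Y Z] by (simp add: diff_eq_eq)
    with neg show ?thesis
      by (simp add: diff_eq_eq ac_simps conj_commute)
  qed
  finally show ?thesis .
qed

end
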